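(* The integral $Q_{0}(a)$, depending on the parameter $a$, is given by $$Q_{0}(a) = \int_{0}^{1} e^{-ax} \ln x \, dx = -\frac{1}{a} \left( \gamma + \ln a + \Gamma(0,a) \right).$$
   Context: $Q_{0}(a)$ is the case $n=0$ (the initial condition) of the family $Q_{n}(a) = \int_{0}^{1} x^{n} e^{-ax} \ln x \, dx$. Here $\gamma = \lim_{n\to\infty}\left(\sum_{k=1}^{n} \frac{1}{k} - \ln n\right)$ is Euler's constant, and $\Gamma(0,a)$ is the value at $s=0$, $x=a$ of the incomplete gamma function $\Gamma(s,x) = \int_{x}^{\infty} t^{s-1} e^{-t}\, dt$. *)

theory Defs
  imports "HOL-Analysis.Analysis"
begin

text \<open>Henstock--Kurzweil integrals agree with the (convergent) improper Riemann integrals.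
  At the endpoint \<open>0\<close> the integrand of \<open>Q\<close> takes the conventional value given by \<open>ln 0 = 0\<close>,
  which does not affect the integral.\<close>

definition Q :: "nat \<Rightarrow> real \<Rightarrow> real" where
  "Q n a = integral {0..1} (\<lambda>x. x ^ n * exp (- a * x) * ln x)"

definition upper_incomplete_Gamma :: "real \<Rightarrow> real \<Rightarrow> real" where
  "upper_incomplete_Gamma s x = integral {x..} (\<lambda>t. t powr (s - 1) * exp (- t))"

end

theory Submission
  imports Defs
begin

text \<open>Integrating by parts against \<open>(1 - exp (- a x)) / a\<close>, the antiderivative of \<open>exp (- a x)\<close>
  that vanishes at \<open>0\<close>, turns the integral into \<open>- Ein a / a\<close>, where \<open>Ein a\<close> is the integral of
  \<open>(1 - exp (- t)) / t\<close> over \<open>[0, a]\<close>. Since \<open>1 / t\<close> integrates to \<open>ln b - ln a\<close> over \<open>[a, b]\<close>,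
  the difference of \<open>Ein b - ln b\<close> and \<open>Ein a - ln a\<close> is minus the integral of \<open>exp (- t) / t\<close>
  over \<open>[a, b]\<close>; letting \<open>b\<close> tend to infinity reduces the claim to \<open>Ein n - ln n\<close> tending to
  Euler's constant. That holds because the harmonic number \<open>H\<^sub>n\<close> is the integral of
  \<open>(1 - (1 - t / n) ^ n) / t\<close> over \<open>[0, n]\<close> and exceeds \<open>Ein n\<close> by at most \<open>1 / n\<close>.\<close>

lemma tendsto_one_minus_exp_over:
  fixes a :: real
  shows "((\<lambda>x. (1 - exp (- a * x)) / x) \<longlongrightarrow> a) (at 0)"
proof -
  have "((\<lambda>x. 1 - exp (- a * x)) has_real_derivative a) (at 0)"
    by (auto intro!: derivative_eq_intros)
  then show ?thesis
    by (simp add: has_field_derivative_iff)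
qed

lemma tendsto_one_minus_exp_times_ln:
  fixes a :: real
  shows "((\<lambda>x. (1 - exp (- a * x)) * ln x) \<longlongrightarrow> 0) (at_right 0)"
proof -
  have "((\<lambda>x. (1 - exp (- a * x)) / x) \<longlongrightarrow> a) (at_right 0)"
    using tendsto_one_minus_exp_over by (rule tendsto_within_subset) simp
  moreover have "((\<lambda>x::real. x * ln x) \<longlongrightarrow> 0) (at_right 0)"
    by real_asymp
  ultimately have "((\<lambda>x. (1 - exp (- a * x)) / x * (x * ln x)) \<longlongrightarrow> a * 0) (at_right 0)"
    by (rule tendsto_mult)
  moreover have "eventually (\<lambda>x. (1 - exp (- a * x)) / x * (x * ln x)
      = (1 - exp (- a * x)) * ln x) (at_right 0)"
    by (simp add: eventually_at_filter)
  ultimately have "((\<lambda>x. (1 - exp (- a * x)) * ln x) \<longlongrightarrow> a * 0) (at_right 0)"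
    by (rule Lim_transform_eventually)
  then show ?thesis
    by simp
qed

lemma integrable_one_minus_exp_over:
  fixes a c d :: real
  shows "(\<lambda>x. (1 - exp (- a * x)) / x) integrable_on {c..d}"
proof -
  define f where "f x = (if x = 0 then a else (1 - exp (- a * x)) / x)" for x
  have "isCont f x" for x
  proof (cases "x = 0")
    case True
    have "(f \<longlongrightarrow> a) (at 0)"
      by (rule Lim_transform_eventually[OF tendsto_one_minus_exp_over])
        (simp add: f_def eventually_at_filter)
    then show ?thesis
      using True by (simp add: isCont_def f_def)
  next
    case False
    have "isCont (\<lambda>x. (1 - exp (- a * x)) / x) x"
      using False by (intro continuous_intros)
    moreover have "eventually (\<lambda>y. f y = (1 - exp (- a * y)) / y) (nhds x)"
      using t1_space_nhds[OF False] by eventually_elim (simp add: f_def)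
    ultimately show ?thesis
      by (simp add: isCont_cong)
  qed
  then have "f integrable_on {c..d}"
    by (intro integrable_continuous_real continuous_at_imp_continuous_on ballI)
  then show ?thesis
    by (rule integrable_spike_finite[of "{0}", rotated 2]) (auto simp: f_def)
qed

text \<open>The integral of \<open>(1 - exp (- t)) / t\<close> from \<open>0\<close> to \<open>a\<close>, rescaled to \<open>[0, 1]\<close> so that it has the
  right value for negative \<open>a\<close> as well.\<close>

definition Ein :: "real \<Rightarrow> real" where
  "Ein a = integral {0..1} (\<lambda>x. (1 - exp (- a * x)) / x)"

lemma Ein_altdef:
  assumes "a \<ge> 0"
  shows "Ein a = integral {0..a} (\<lambda>t. (1 - exp (- t)) / t)"
proof (cases "a = 0")
  case False
  have "(1 - exp (- a * x)) / x = a * ((1 - exp (- (a * x))) / (a * x))" for x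
    using False by simp
  then have "Ein a = a * integral {0..1} (\<lambda>x. (1 - exp (- (a * x))) / (a * x))"
    unfolding Ein_def by (simp only: integral_mult_right)
  also have "{0..1} = (\<lambda>x. x / a) ` {0..a}"
    using assms False by simp
  also have "a * integral \<dots> (\<lambda>x. (1 - exp (- (a * x))) / (a * x))
      = integral {0..a} (\<lambda>t. (1 - exp (- t)) / t)"
    using assms False integral_stretch_real[of a 0 a "\<lambda>t. (1 - exp (- t)) / t"] by simp
  finally show ?thesis .
qed (simp add: Ein_def)

lemma has_integral_Ein:
  assumes "a \<ge> 0"
  shows "((\<lambda>t. (1 - exp (- t)) / t) has_integral Ein a) {0..a}"
  using integrable_one_minus_exp_over[of 1 0 a] Ein_altdef[OF assms]
  by (simp add: has_integral_iff)

lemma has_integral_exp_times_ln: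
  fixes a :: real
  assumes "a \<noteq> 0"
  shows "((\<lambda>x. exp (- a * x) * ln x) has_integral - Ein a / a) {0..1}"
proof -
  define G where "G = (\<lambda>x. (1 - exp (- a * x)) * ln x / a)"
  have "((\<lambda>x. exp (- a * x) * ln x + (1 - exp (- a * x)) / x / a) has_integral G 1 - G 0) {0..1}"
  proof (rule fundamental_theorem_of_calculus_interior)
    have "(G \<longlongrightarrow> G 0) (at_right 0)"
      using tendsto_divide_zero[OF tendsto_one_minus_exp_times_ln, of a a] by (simp add: G_def)
    moreover have "(G \<longlongrightarrow> G x) (at x)" if "x > 0" for x
      unfolding G_def using that assms by (auto intro!: tendsto_intros)
    moreover from this[of 1] have "(G \<longlongrightarrow> G 1) (at_left 1)"
      by (auto intro: tendsto_within_subset)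
    ultimately show "continuous_on {0..1} G"
      by (intro continuous_on_IccI) simp_all
  next
    fix x :: real
    assume "x \<in> {0<..<1}"
    then have "(G has_real_derivative exp (- a * x) * ln x + (1 - exp (- a * x)) / x / a) (at x)"
      unfolding G_def using assms by (auto intro!: derivative_eq_intros simp: field_simps)
    then show "(G has_vector_derivative exp (- a * x) * ln x + (1 - exp (- a * x)) / x / a) (at x)"
      by (simp add: has_real_derivative_iff_has_vector_derivative)
  qed simp
  then have "((\<lambda>x. exp (- a * x) * ln x + (1 - exp (- a * x)) / x / a) has_integral 0) {0..1}"
    by (simp add: G_def)
  moreover have "((\<lambda>x. (1 - exp (- a * x)) / x / a) has_integral Ein a / a) {0..1}"
    unfolding Ein_def
    by (intro has_integral_divide integrable_integral integrable_one_minus_exp_over)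
  ultimately have "((\<lambda>x. exp (- a * x) * ln x + (1 - exp (- a * x)) / x / a
      - (1 - exp (- a * x)) / x / a) has_integral 0 - Ein a / a) {0..1}"
    by (rule has_integral_diff)
  then show ?thesis
    by simp
qed

lemma has_integral_harm:
  "((\<lambda>t. (1 - (1 - t / real n) ^ n) / t) has_integral harm n) {0..real n}"
proof (cases "n = 0")
  case True
  then show ?thesis
    by (simp add: harm_def has_integral_refl)
next
  case False
  define F where "F t = - (\<Sum>k<n. (1 - t / real n) ^ Suc k / real (Suc k))" for t
  have "((\<lambda>t. (\<Sum>k<n. (1 - t / real n) ^ k) / real n) has_integral F n - F 0) {0..real n}"
  proof (rule fundamental_theorem_of_calculus)
    fix t :: real
    have "((\<lambda>t. (1 - t / real n) ^ Suc k / real (Suc k)) has_real_derivative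
             real (Suc k) * (1 - t / real n) ^ k * - (1 / real n) / real (Suc k))
            (at t within {0..real n})" for k
      using False by (intro DERIV_cdivide) (auto intro!: derivative_eq_intros simp del: power_Suc)
    then have "((\<lambda>t. (1 - t / real n) ^ Suc k / real (Suc k)) has_real_derivative
                  - ((1 - t / real n) ^ k / real n)) (at t within {0..real n})" for k
      by simp
    then have "(F has_real_derivative - (\<Sum>k<n. - ((1 - t / real n) ^ k / real n)))
                 (at t within {0..real n})"
      unfolding F_def by (intro DERIV_minus DERIV_sum)
    then show "(F has_vector_derivative (\<Sum>k<n. (1 - t / real n) ^ k) / real n)
                 (at t within {0..real n})"
      by (simp add: has_real_derivative_iff_has_vector_derivative sum_negf sum_divide_distrib)
  qed simp
  also have "F n - F 0 = harm n"
    using False by (simp add: F_def harm_altdef inverse_eq_divide)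
  finally show ?thesis
  proof (rule has_integral_spike_finite[of "{0}", rotated 2])
    fix t
    assume "t \<in> {0..real n} - {0}"
    then show "(1 - (1 - t / real n) ^ n) / t = (\<Sum>k<n. (1 - t / real n) ^ k) / real n"
      using False one_diff_power_eq[of "1 - t / real n" n] by simp
  qed simp
qed

lemma exp_minus_diff_power_le:
  fixes t :: real
  assumes "0 \<le> t" "t \<le> real n" "n > 0"
  shows "exp (- t) - (1 - t / real n) ^ n \<le> t\<^sup>2 * exp (- t) / real n"
proof -
  have "1 - t\<^sup>2 / real n = 1 + real n * - (t / real n)\<^sup>2"
    using assms by (simp add: power2_eq_square)
  also have "\<dots> \<le> (1 - (t / real n)\<^sup>2) ^ n"
    using Bernoulli_inequality[of "- (t / real n)\<^sup>2" n] assms by (simp add: power_le_one)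
  also have "\<dots> = (1 - t / real n) ^ n * (1 + t / real n) ^ n"
    by (simp add: power2_eq_square algebra_simps flip: power_mult_distrib)
  also have "\<dots> \<le> (1 - t / real n) ^ n * exp t"
    using assms by (intro mult_left_mono exp_ge_one_plus_x_over_n_power_n) auto
  finally have "(1 - t\<^sup>2 / real n) * exp (- t) \<le> (1 - t / real n) ^ n"
    by (simp add: exp_minus field_simps)
  then show ?thesis
    by (simp add: algebra_simps)
qed

lemma has_integral_ident_times_exp_minus:
  fixes a b :: real
  assumes "a \<le> b"
  shows "((\<lambda>t. t * exp (- t)) has_integral (a + 1) * exp (- a) - (b + 1) * exp (- b)) {a..b}"
proof -
  have "((\<lambda>t. - (t + 1) * exp (- t)) has_real_derivative t * exp (- t)) (at t within {a..b})" for t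
    by (auto intro!: derivative_eq_intros simp: algebra_simps)
  then have "((\<lambda>t. t * exp (- t)) has_integral
      - (b + 1) * exp (- b) - - (a + 1) * exp (- a)) {a..b}"
    by (intro fundamental_theorem_of_calculus assms)
      (simp add: has_real_derivative_iff_has_vector_derivative)
  then show ?thesis
    by (simp add: algebra_simps)
qed

lemma harm_minus_Ein_bounds:
  assumes "n > 0"
  shows "harm n - Ein (real n) \<in> {0..1 / real n}"
proof -
  have diff_integral: "((\<lambda>t. (exp (- t) - (1 - t / real n) ^ n) / t) has_integral
      harm n - Ein (real n)) {0..real n}"
    using has_integral_diff[OF has_integral_harm has_integral_Ein[of "real n"]]
    by (simp flip: diff_divide_distrib)
  have "(1 - t / real n) ^ n \<le> exp (- t)" if "t \<in> {0..real n}" for t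
    using that assms by (intro exp_ge_one_minus_x_over_n_power_n) auto
  then have "0 \<le> harm n - Ein (real n)"
    by (intro has_integral_nonneg[OF diff_integral]) simp
  moreover have "harm n - Ein (real n) \<le> (1 - (real n + 1) * exp (- real n)) / real n"
  proof (rule has_integral_le[OF diff_integral])
    show "((\<lambda>t. t * exp (- t) / real n) has_integral
        (1 - (real n + 1) * exp (- real n)) / real n) {0..real n}"
      using has_integral_divide[OF has_integral_ident_times_exp_minus[of 0 "real n"]] by simp
    show "(exp (- t) - (1 - t / real n) ^ n) / t \<le> t * exp (- t) / real n"
      if "t \<in> {0..real n}" for t
      using that assms exp_minus_diff_power_le[of t n]
      by (cases "t = 0") (auto simp: divide_le_eq power2_eq_square mult_ac)
  qed
  moreover have "(1 - (real n + 1) * exp (- real n)) / real n \<le> 1 / real n"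
    by (simp add: divide_right_mono)
  ultimately show ?thesis
    by simp
qed

lemma Ein_minus_ln_LIMSEQ: "(\<lambda>n. Ein (real n) - ln (real n)) \<longlonglongrightarrow> euler_mascheroni"
proof -
  have "(\<lambda>n. harm n - Ein (real n)) \<longlonglongrightarrow> 0"
  proof (rule tendsto_sandwich[OF _ _ tendsto_const lim_1_over_n])
    show "eventually (\<lambda>n. 0 \<le> harm n - Ein (real n)) sequentially"
      and "eventually (\<lambda>n. harm n - Ein (real n) \<le> 1 / real n) sequentially"
      using eventually_gt_at_top[of 0]
      by (eventually_elim, use harm_minus_Ein_bounds in force)+
  qed
  from tendsto_diff[OF euler_mascheroni_LIMSEQ this] show ?thesis
    by simp
qed

lemma absolutely_integrable_upper_incomplete_Gamma:
  fixes a s :: real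
  assumes "a > 0"
  shows "(\<lambda>t. t powr (s - 1) * exp (- t)) absolutely_integrable_on {a..}"
proof -
  define r where "r = max s 1"
  have "(\<lambda>t. t powr (r - 1) / exp t) absolutely_integrable_on {0..}"
    using Gamma_integral_real[of r]
    by (intro nonnegative_absolutely_integrable_1 has_integral_integrable)
      (auto simp: r_def less_max_iff_disj)
  then have "(\<lambda>t. t powr (r - 1) / exp t) absolutely_integrable_on {a..}"
    by (rule set_integrable_subset) (use assms in auto)
  then have dominant: "(\<lambda>t. a powr (s - r) * (t powr (r - 1) / exp t)) integrable_on {a..}"
    by (intro integrable_on_mult_right set_lebesgue_integral_eq_integral)
  show ?thesis
  proof (rule measurable_bounded_by_integrable_imp_absolutely_integrable[OF _ _ dominant])
    show "(\<lambda>t. t powr (s - 1) * exp (- t)) \<in> borel_measurable (lebesgue_on {a..})"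
      using assms
      by (intro continuous_imp_measurable_on_sets_lebesgue) (auto intro!: continuous_intros)
    show "norm (t powr (s - 1) * exp (- t)) \<le> a powr (s - r) * (t powr (r - 1) / exp t)"
      if "t \<in> {a..}" for t
    proof -
      have "t powr (s - 1) = t powr (s - r) * t powr (r - 1)"
        by (simp flip: powr_add)
      also have "\<dots> \<le> a powr (s - r) * t powr (r - 1)"
        using that assms by (intro mult_right_mono powr_mono2') (auto simp: r_def)
      finally show ?thesis
        by (simp add: exp_minus field_simps)
    qed
  qed simp
qed

lemma tendsto_integral_upper_incomplete_Gamma:
  assumes "a > 0"
  shows "((\<lambda>b. integral {a..b} (\<lambda>t. t powr (s - 1) * exp (- t)))
           \<longlongrightarrow> upper_incomplete_Gamma s a) at_top"
proof -
  let ?f = "\<lambda>t. t powr (s - 1) * exp (- t)"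
  note integrable = absolutely_integrable_upper_incomplete_Gamma[OF assms, of s]
  have "?f absolutely_integrable_on {a..b}" for b
    using integrable by (rule set_integrable_subset) auto
  then have "(LINT t:{a..b}|lebesgue. ?f t) = integral {a..b} ?f" for b
    by (rule set_lebesgue_integral_eq_integral)
  moreover have "(LINT t:{a..}|lebesgue. ?f t) = upper_incomplete_Gamma s a"
    unfolding upper_incomplete_Gamma_def using integrable
    by (rule set_lebesgue_integral_eq_integral)
  ultimately show ?thesis
    using tendsto_set_lebesgue_integral_at_top[OF _ integrable] by simp
qed

lemma Ein_diff:
  assumes "0 < a" "a \<le> b"
  shows "Ein b - Ein a = ln b - ln a - integral {a..b} (\<lambda>t. exp (- t) / t)"
proof -
  have "((\<lambda>t. 1 / t) has_integral ln b - ln a) {a..b}"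
  proof (rule fundamental_theorem_of_calculus[OF assms(2)])
    fix t
    assume "t \<in> {a..b}"
    then have "(ln has_real_derivative 1 / t) (at t within {a..b})"
      using assms by (auto intro!: derivative_eq_intros)
    then show "(ln has_vector_derivative 1 / t) (at t within {a..b})"
      by (simp add: has_real_derivative_iff_has_vector_derivative)
  qed
  moreover have "(\<lambda>t. exp (- t) / t) integrable_on {a..b}"
    using assms by (intro integrable_continuous_real continuous_intros) auto
  ultimately have "integral {a..b} (\<lambda>t. (1 - exp (- t)) / t)
      = ln b - ln a - integral {a..b} (\<lambda>t. exp (- t) / t)"
    unfolding diff_divide_distrib
    by (intro integral_unique has_integral_diff integrable_integral)
  moreover have "Ein a + integral {a..b} (\<lambda>t. (1 - exp (- t)) / t) = Ein b"
    using integrable_one_minus_exp_over[of 1] assms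
    by (simp add: Ein_altdef Henstock_Kurzweil_Integration.integral_combine)
  ultimately show ?thesis
    by simp
qed

lemma Ein_eq_upper_incomplete_Gamma:
  assumes "a > 0"
  shows "Ein a = euler_mascheroni + ln a + upper_incomplete_Gamma 0 a"
proof -
  have "(\<lambda>n. Ein (real n) - ln (real n)
           + integral {a..real n} (\<lambda>t. t powr (0 - 1) * exp (- t)))
         \<longlonglongrightarrow> euler_mascheroni + upper_incomplete_Gamma 0 a"
    by (intro tendsto_add Ein_minus_ln_LIMSEQ filterlim_real_sequentially
        filterlim_compose[OF tendsto_integral_upper_incomplete_Gamma[OF assms]])
  moreover have "eventually (\<lambda>n. Ein (real n) - ln (real n)
      + integral {a..real n} (\<lambda>t. t powr (0 - 1) * exp (- t)) = Ein a - ln a) sequentially"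
    using eventually_ge_at_top[of "nat \<lceil>a\<rceil>"]
  proof eventually_elim
    case (elim n)
    have "integral {a..real n} (\<lambda>t. t powr (0 - 1) * exp (- t))
        = integral {a..real n} (\<lambda>t. exp (- t) / t)"
      using assms by (intro integral_cong) (simp add: powr_minus_divide)
    then show ?case
      using Ein_diff[OF assms, of "real n"] elim by linarith
  qed
  ultimately have "(\<lambda>n. Ein a - ln a) \<longlonglongrightarrow> euler_mascheroni + upper_incomplete_Gamma 0 a"
    by (rule Lim_transform_eventually)
  then show ?thesis
    by (simp add: LIMSEQ_const_iff)
qed

theorem lemma4p2:
  fixes a :: real
  assumes "a > 0"
  shows "Q 0 a = integral {0..1} (\<lambda>x. exp (- a * x) * ln x) \<and>
         integral {0..1} (\<lambda>x. exp (- a * x) * ln x)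
           = - (1 / a) * (euler_mascheroni + ln a + upper_incomplete_Gamma 0 a)"
proof
  show "Q 0 a = integral {0..1} (\<lambda>x. exp (- a * x) * ln x)"
    by (simp add: Q_def)
  have "integral {0..1} (\<lambda>x. exp (- a * x) * ln x) = - (1 / a) * Ein a"
    using has_integral_exp_times_ln[of a] assms by (intro integral_unique) simp
  then show "integral {0..1} (\<lambda>x. exp (- a * x) * ln x)
      = - (1 / a) * (euler_mascheroni + ln a + upper_incomplete_Gamma 0 a)"
    unfolding Ein_eq_upper_incomplete_Gamma[OF assms] .
qed

end
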